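(* For every $a\in\mathbb{N}$, the numerical semigroup $T(a)$ satisfies Wilf's conjecture, that is, $\mathrm{F}(T(a))+1\leq \mathrm{e}(T(a))\,\mathrm{n}(T(a))$.
   Context: $\mathbb{N}=\{0,1,2,\ldots\}$. The Lucas series $\{l_n\}_{n\in\mathbb{N}}$ is defined by $l_0=2$, $l_1=1$, $l_{n+2}=l_{n+1}+l_n$. For $a\in\mathbb{N}$, $T(a)$ is the submonoid of $(\mathbb{N},+)$ generated by $\{l_a+l_n\mid n\in\mathbb{N}\}$; it is a numerical semigroup, i.e. $\mathbb{N}\setminus T(a)$ is finite. For a numerical semigroup $S$: $\mathrm{F}(S)$ is the greatest integer not belonging to $S$; $\mathrm{e}(S)$ is the cardinality of the unique minimal (with respect to inclusion) system of generators of $S$; $\mathrm{n}(S)$ is the cardinality of $\{s\in S\mid s<\mathrm{F}(S)\}$. *)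

theory Defs
  imports Complex_Main
begin

fun lucas :: "nat \<Rightarrow> nat" where
  "lucas 0 = 2"
| "lucas (Suc 0) = 1"
| "lucas (Suc (Suc n)) = lucas (Suc n) + lucas n"

definition submonoid :: "nat set \<Rightarrow> bool" where
  "submonoid S \<longleftrightarrow> 0 \<in> S \<and> (\<forall>x\<in>S. \<forall>y\<in>S. x + y \<in> S)"

definition submonoid_generated :: "nat set \<Rightarrow> nat set" where
  "submonoid_generated A = submonoid hull A"

definition numerical_semigroup :: "nat set \<Rightarrow> bool" where
  "numerical_semigroup S \<longleftrightarrow> submonoid S \<and> finite (- S)"

(* The greatest integer (not natural number) outside S, so the value for S = UNIV is -1. *)
definition frobenius_number :: "nat set \<Rightarrow> int" where
  "frobenius_number S = (GREATEST z. z \<notin> int ` S)"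

definition minimal_generating_system :: "nat set \<Rightarrow> nat set \<Rightarrow> bool" where
  "minimal_generating_system S A \<longleftrightarrow>
     submonoid_generated A = S \<and> (\<forall>B. B \<subset> A \<longrightarrow> submonoid_generated B \<noteq> S)"

definition embedding_dimension :: "nat set \<Rightarrow> nat" where
  "embedding_dimension S = card (THE A. minimal_generating_system S A)"

definition num_below_frobenius :: "nat set \<Rightarrow> nat" where
  "num_below_frobenius S = card {s \<in> S. int s < frobenius_number S}"

definition T :: "nat \<Rightarrow> nat set" where
  "T a = submonoid_generated (range (\<lambda>n. lucas a + lucas n))"

lemma submonoid_submonoid_generated: "submonoid (submonoid_generated A)"
  unfolding submonoid_generated_def hull_def submonoid_def by blast

lemma submonoid_mult: "submonoid S \<Longrightarrow> x \<in> S \<Longrightarrow> k * x \<in> S"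
  by (induction k) (auto simp: submonoid_def)

lemma numerical_semigroup_T: "numerical_semigroup (T a)"
proof -
  define m where "m = lucas a + 1"
  have sub: "submonoid (T a)"
    by (simp add: T_def submonoid_submonoid_generated)
  have gen: "lucas a + lucas n \<in> T a" for n
    unfolding T_def submonoid_generated_def by (rule hull_inc) blast
  have m1: "m \<in> T a" and m2: "m + 1 \<in> T a"
    using gen[of 1] gen[of 0] by (simp_all add: m_def numeral_2_eq_2)
  have "x \<in> T a" if "x \<ge> m * m" for x
  proof -
    have "m > 0" by (simp add: m_def)
    then have le: "x mod m \<le> x div m"
      using that by (meson div_le_mono less_imp_le_nat less_le_trans
        mod_less_divisor nonzero_mult_div_cancel_left order_trans
        div_greater_zero_iff less_eq_div_iff_mult_less_eq)
    have "x = m * (x div m) + x mod m" by simp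
    also have "x div m = (x div m - x mod m) + x mod m" using le by simp
    finally have "x = (x div m - x mod m) * m + (x mod m) * (m + 1)"
      by (simp add: algebra_simps)
    then show ?thesis
      using sub submonoid_mult[OF sub m1] submonoid_mult[OF sub m2]
      unfolding submonoid_def by metis
  qed
  then have "- T a \<subseteq> {..< m * m}" by (force simp: not_le[symmetric])
  then show ?thesis
    using sub finite_subset by (auto simp: numerical_semigroup_def)
qed

end

(* Write L = l_a, m = L + 1, K = a div 2. An element of T(a) has the form j * m + w with w a sum
   of at most j of the numbers l_n - 1, and every w <= L is a sum of at most K of them (a >= 4),
   so F + 1 <= K * m. The same fact for a - 2 and a - 4 fills the first l_(a-2), respectively
   l_(a-4), places of the blocks K - 1 and K - 2, and these are more than m / 2 elements in total.
   They all lie below the gap K * L - 1; that this is a gap follows from the optimality of the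
   greedy algorithm for the coins l_0, ..., l_a. As the a + 1 generators L + l_n with n <= a are
   below 2 * m, they are indecomposable, so e >= a + 1 >= 2 * K and e * n >= K * m. *)

theory Submission imports Defs begin

section \<open>A criterion for Wilf's inequality\<close>

lemma submonoid_generated_subset: "submonoid S \<Longrightarrow> A \<subseteq> S \<Longrightarrow> submonoid_generated A \<subseteq> S"
  unfolding submonoid_generated_def by (simp add: hull_minimal)

lemma submonoid_generated_inc: "A \<subseteq> submonoid_generated A"
  unfolding submonoid_generated_def by (simp add: hull_subset)

section \<open>Indecomposable elements and the embedding dimension\<close>

definition atoms :: "nat set \<Rightarrow> nat set" where
  "atoms S = {x \<in> S. x \<noteq> 0 \<and> (\<forall>y\<in>S. \<forall>z\<in>S. x = y + z \<longrightarrow> y = 0 \<or> z = 0)}"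

text \<open>Strong induction: a nonzero element of \<open>S\<close> that is not an atom splits into
  two strictly smaller elements of \<open>S\<close>.\<close>

lemma submonoid_generated_atoms:
  assumes S: "submonoid S"
  shows "submonoid_generated (atoms S) = S"
proof
  show "submonoid_generated (atoms S) \<subseteq> S"
    using S by (intro submonoid_generated_subset) (auto simp: atoms_def)
  have sub: "submonoid (submonoid_generated (atoms S))"
    by (rule submonoid_submonoid_generated)
  have "x \<in> S \<longrightarrow> x \<in> submonoid_generated (atoms S)" for x
  proof (induction x rule: less_induct)
    case (less x)
    consider "x = 0" | "x \<in> atoms S" | "x \<notin> S"
      | y z where "y \<in> S" "z \<in> S" "x = y + z" "y < x" "z < x"
      unfolding atoms_def by force
    then show ?case
    proof cases
      case 1
      then show ?thesis using sub by (simp add: submonoid_def)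
    next
      case 2
      then show ?thesis using submonoid_generated_inc by blast
    next
      case 4
      then show ?thesis using sub less.IH by (auto simp: submonoid_def)
    qed simp
  qed
  then show "S \<subseteq> submonoid_generated (atoms S)" by blast
qed

text \<open>Removing an atom from \<open>S\<close> leaves a submonoid. If \<open>A\<close> omitted
  the atom, it would generate no more than this smaller submonoid.\<close>

lemma atoms_subset_generators:
  assumes "submonoid_generated A = S"
  shows "atoms S \<subseteq> A"
proof
  fix x assume x: "x \<in> atoms S"
  have S: "submonoid S" using assms submonoid_submonoid_generated by blast
  show "x \<in> A"
  proof (rule ccontr)
    assume "x \<notin> A"
    then have "A \<subseteq> S - {x}" using assms submonoid_generated_inc[of A] by auto
    moreover have "submonoid (S - {x})"
      unfolding submonoid_def
    proof (intro conjI ballI)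
      show "0 \<in> S - {x}" using S x by (simp add: submonoid_def atoms_def)
      fix y z assume yz: "y \<in> S - {x}" "z \<in> S - {x}"
      then have "y + z \<in> S" using S by (simp add: submonoid_def)
      moreover have "y = 0 \<or> z = 0" if "x = y + z"
        using x yz that unfolding atoms_def by blast
      then have "x \<noteq> y + z" using yz by auto
      ultimately show "y + z \<in> S - {x}" by simp
    qed
    ultimately have "S \<subseteq> S - {x}" using submonoid_generated_subset assms by metis
    then show False using x by (auto simp: atoms_def)
  qed
qed

lemma embedding_dimension_eq_card_atoms:
  assumes S: "submonoid S"
  shows "embedding_dimension S = card (atoms S)"
proof -
  have "(THE A. minimal_generating_system S A) = atoms S"
  proof (rule the_equality)
    show "minimal_generating_system S (atoms S)"
      using submonoid_generated_atoms[OF S] atoms_subset_generators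
      unfolding minimal_generating_system_def by blast
    show "A = atoms S" if A: "minimal_generating_system S A" for A
    proof -
      have "atoms S \<subseteq> A"
        using A by (intro atoms_subset_generators) (simp add: minimal_generating_system_def)
      moreover have "\<not> atoms S \<subset> A"
        using A submonoid_generated_atoms[OF S] by (auto simp: minimal_generating_system_def)
      ultimately show ?thesis by auto
    qed
  qed
  then show ?thesis by (simp add: embedding_dimension_def)
qed

lemma frobenius_number_eq_Max:
  assumes "finite (- S)" "- S \<noteq> {}"
  shows "frobenius_number S = int (Max (- S))"
  unfolding frobenius_number_def
proof (rule Greatest_equality)
  show "int (Max (- S)) \<notin> int ` S"
    using Max_in[OF assms] by auto
  fix z assume "z \<notin> int ` S"
  \<comment> \<open>Negative integers are outside the image of \<open>S\<close> too, but they lie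
    below the maximal gap, a natural number.\<close>
  then show "z \<le> int (Max (- S))"
    using Max_ge[OF assms(1), of "nat z"] by (cases "z \<ge> 0") (force simp: image_iff)+
qed

text \<open>This avoids computing the three invariants: F < \<open>N\<close> bounds the left side,
  the elements of \<open>C\<close> are atoms because two nonzero summands add up to at least
  \<open>2 * m\<close>, and \<open>B\<close> lies below F because the gap \<open>f\<close> is at
  most F.\<close>

lemma wilf_criterion:
  assumes S: "submonoid S"
    and cofinite: "\<And>x. x \<ge> N \<Longrightarrow> x \<in> S"
    and mult: "\<And>s. s \<in> S \<Longrightarrow> s \<noteq> 0 \<Longrightarrow> m \<le> s"
    and C: "C \<subseteq> S \<inter> {m..<2 * m}"
    and B: "B \<subseteq> S \<inter> {..<f}" and f: "f \<notin> S"
    and le: "N \<le> card C * card B"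
  shows "frobenius_number S + 1 \<le> int (embedding_dimension S) * int (num_below_frobenius S)"
proof -
  have gaps: "- S \<subseteq> {..<N}" using cofinite by (force simp: not_le[symmetric])
  then have fin: "finite (- S)" by (rule finite_subset) simp
  have ne: "- S \<noteq> {}" using f by blast
  note F = frobenius_number_eq_Max[OF fin ne]
  have "frobenius_number S < int N" using Max_in[OF fin ne] gaps F by auto
  moreover have "int f \<le> frobenius_number S" using F fin f by simp
  then have "B \<subseteq> {s \<in> S. int s < frobenius_number S}" using B by auto
  then have "card B \<le> num_below_frobenius S"
    unfolding num_below_frobenius_def F by (intro card_mono) auto
  moreover have "card C \<le> embedding_dimension S"
    unfolding embedding_dimension_eq_card_atoms[OF S]
  proof (rule card_mono)
    \<comment> \<open>Finiteness is needed for comparing cardinalities. Splitting off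
      \<open>N + 1\<close> rather than \<open>N\<close> keeps the summand nonzero even if
      \<open>N = 0\<close>.\<close>
    have "atoms S \<subseteq> {..2 * N + 1}"
    proof
      fix x assume x: "x \<in> atoms S"
      show "x \<in> {..2 * N + 1}"
      proof (rule ccontr)
        assume "x \<notin> {..2 * N + 1}"
        then have "N + 1 \<in> S" "x - (N + 1) \<in> S" "x = (N + 1) + (x - (N + 1))"
          "x - (N + 1) \<noteq> 0" using cofinite by auto
        then show False using x unfolding atoms_def by fastforce
      qed
    qed
    then show "finite (atoms S)" by (rule finite_subset) simp
    show "C \<subseteq> atoms S"
    proof
      fix x assume "x \<in> C"
      then have x: "x \<in> S" "m \<le> x" "x < 2 * m" using C by auto
      then have "y = 0 \<or> z = 0" if "y \<in> S" "z \<in> S" "x = y + z" for y z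
        using that mult[of y] mult[of z] by fastforce
      then show "x \<in> atoms S" using x by (auto simp: atoms_def)
    qed
  qed
  ultimately have "frobenius_number S < int N"
    "N \<le> embedding_dimension S * num_below_frobenius S"
    using le by (auto intro: order_trans[OF _ mult_le_mono])
  then show ?thesis by (simp flip: of_nat_mult)
qed


section \<open>Sums of a bounded number of coins\<close>

primrec coin_sums :: "nat set \<Rightarrow> nat \<Rightarrow> nat set" where
  "coin_sums C 0 = {0}"
| "coin_sums C (Suc k) = coin_sums C k \<union> {c + x | c x. c \<in> C \<and> x \<in> coin_sums C k}"

lemma coin_sums_add_coin: "c \<in> C \<Longrightarrow> x \<in> coin_sums C k \<Longrightarrow> c + x \<in> coin_sums C (Suc k)"
  by auto

lemma coin_sums_mono: "j \<le> k \<Longrightarrow> coin_sums C j \<subseteq> coin_sums C k"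
  by (rule lift_Suc_mono_le[of "coin_sums C"]) auto

lemma zero_in_coin_sums: "0 \<in> coin_sums C k"
  by (induction k) auto

lemma coin_in_coin_sums: "c \<in> C \<Longrightarrow> c \<in> coin_sums C (Suc k)"
  using coin_sums_add_coin[OF _ zero_in_coin_sums] by fastforce

lemma coin_sums_mono_coins: "C \<subseteq> D \<Longrightarrow> coin_sums C k \<subseteq> coin_sums D k"
  by (induction k) fastforce+

lemma coin_sums_add:
  "x \<in> coin_sums C j \<Longrightarrow> y \<in> coin_sums C k \<Longrightarrow> x + y \<in> coin_sums C (j + k)"
proof (induction j arbitrary: x)
  case 0
  then show ?case by simp
next
  case (Suc j)
  show ?case
  proof (cases "x \<in> coin_sums C j")
    case True
    then show ?thesis using Suc by auto
  next
    case False
    then obtain c x' where "c \<in> C" "x' \<in> coin_sums C j" "x = c + x'" using Suc.prems by auto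
    then show ?thesis using Suc.IH[of x'] Suc.prems coin_sums_add_coin[of c C "x' + y" "j + k"]
      by (simp add: add.assoc)
  qed
qed

text \<open>Either the coin \<open>c\<close> is avoided, or by commutativity one copy of it can be
  moved to the front.\<close>

lemma coin_sums_insert_cases:
  assumes "x \<in> coin_sums (insert c C) k"
  obtains "x \<in> coin_sums C k"
    | j y where "k = Suc j" "x = c + y" "y \<in> coin_sums (insert c C) j"
proof -
  have "x \<in> coin_sums C k \<or> (\<exists>j y. k = Suc j \<and> x = c + y \<and> y \<in> coin_sums (insert c C) j)"
    using assms
  proof (induction k arbitrary: x)
    case 0
    then show ?case by simp
  next
    case (Suc k)
    have *: "z \<in> coin_sums C k \<or> (\<exists>y. z = c + y \<and> y \<in> coin_sums (insert c C) k)"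
      if "z \<in> coin_sums (insert c C) k" for z
      using Suc.IH[OF that] by fastforce
    show ?case
    proof (cases "x \<in> coin_sums (insert c C) k")
      case True
      then show ?thesis using * by auto
    next
      case False
      then obtain d z where dz: "d = c \<or> d \<in> C" "z \<in> coin_sums (insert c C) k" "x = d + z"
        using Suc.prems by auto
      show ?thesis
      proof (cases "d = c")
        case True
        then show ?thesis using dz by blast
      next
        case False
        then have d: "d \<in> C" using dz by simp
        from Suc.IH[OF dz(2)] show ?thesis
        proof
          assume "z \<in> coin_sums C k"
          then show ?thesis using d dz(3) by auto
        next
          assume "\<exists>j y. k = Suc j \<and> z = c + y \<and> y \<in> coin_sums (insert c C) j"
          then obtain j y where "k = Suc j" "z = c + y" "y \<in> coin_sums (insert c C) j" by blast
          \<comment> \<open>The coins \<open>d\<close> and \<open>c\<close> are swapped: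
            \<open>x = c + (d + y)\<close>, and \<open>d + y\<close> uses at most
            \<open>Suc j = k\<close> coins.\<close>
          then show ?thesis
            using d dz(3) coin_sums_add_coin[of d "insert c C" y j]
            by (intro disjI2 exI[of _ k] exI[of _ "d + y"]) auto
        qed
      qed
    qed
  qed
  then show thesis using that by blast
qed

lemma coin_sums_insert_less: "x \<in> coin_sums (insert c C) k \<Longrightarrow> x < c \<Longrightarrow> x \<in> coin_sums C k"
  by (erule coin_sums_insert_cases) auto

text \<open>Settles the base cases of \<open>lucas_greedy\<close>, where the Lucas coins form an
  interval starting at 1.\<close>

lemma coin_sums_atLeastAtMost: "coin_sums {1..p} k = {..p * k}"
proof (induction k)
  case (Suc k)
  have "x \<in> {c + y | c y. c \<in> {1..p} \<and> y \<in> {..p * k}}" if "p * k < x" "x \<le> p * Suc k" for x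
    using that by (intro CollectI exI[of _ "x - p * k"] exI[of _ "p * k"]) auto
  then show ?case unfolding coin_sums.simps Suc.IH by fastforce
qed simp


section \<open>Lucas numbers\<close>

lemma lucas_pos: "0 < lucas n"
  by (induction n rule: lucas.induct) auto

text \<open>The bound \<open>2 \<le> a\<close> avoids the initial descent from 2 to 1.\<close>

lemma lucas_less: "i < a \<Longrightarrow> 2 \<le> a \<Longrightarrow> lucas i < lucas a"
proof (induction a)
  case (Suc a)
  then obtain b where b: "a = Suc b" by (cases a) auto
  have step: "lucas a < lucas (Suc a)" using lucas_pos[of b] b by simp
  show ?case
  proof (cases "i < a \<and> 2 \<le> a")
    case True
    then show ?thesis using Suc.IH step by simp
  next
    case False
    then show ?thesis using Suc.prems step b by (cases "i = a") (auto simp: not_le Suc_le_eq less_Suc_eq)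
  qed
qed simp

lemma lucas_le: "i \<le> a \<Longrightarrow> 2 \<le> a \<Longrightarrow> lucas i \<le> lucas a"
  using lucas_less[of i a] by (cases "i = a") auto

lemma inj_lucas: "inj lucas"
proof (rule linorder_injI)
  fix i j :: nat
  assume "i < j"
  then show "lucas i \<noteq> lucas j"
    using lucas_less[of i j] by (cases "j = 1") auto
qed

lemma le_lucas: "n \<le> lucas n"
proof (induction n rule: lucas.induct)
  case (3 n)
  then show ?case using lucas_pos[of n] by (cases n) auto
qed auto

lemma lucas_values:
  "lucas 1 = 1" "lucas 2 = 3" "lucas 3 = 4" "lucas 4 = 7" "lucas 5 = 11"
  by (simp_all add: eval_nat_numeral)

lemma lucas_coins_base:
  "lucas ` {..2} = {1..3}" "lucas ` {..3} = {1..4}"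
  by (auto simp: eval_nat_numeral atMost_Suc)

text \<open>Optimality of the greedy algorithm: if the coin \<open>lucas a\<close> is not used yet, greedily extract
  \<open>lucas (a - 1)\<close> and then \<open>lucas (a - 2)\<close>, or use \<open>2 * lucas (a - 1) = lucas a + lucas (a - 3)\<close>.\<close>

lemma lucas_greedy:
  "2 \<le> a \<Longrightarrow> lucas a + x \<in> coin_sums (lucas ` {..a}) k \<Longrightarrow>
    \<exists>j. k = Suc j \<and> x \<in> coin_sums (lucas ` {..a}) j"
proof (induction a arbitrary: x k rule: less_induct)
  case (less a)
  consider "a = 2" | "a = 3" | b where "a = Suc (Suc (Suc (Suc b)))"
    using less.prems(1) by (metis One_nat_def Suc_1 not_less_eq_eq numeral_3_eq_3 old.nat.exhaust le0)
  then show ?case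
  proof cases
    case 1
    with less.prems(2) have "3 + x \<le> 3 * k"
      by (simp add: lucas_coins_base coin_sums_atLeastAtMost lucas_values del: One_nat_def)
    then show ?thesis unfolding 1 lucas_coins_base coin_sums_atLeastAtMost
      by (intro exI[of _ "k - 1"]) auto
  next
    case 2
    with less.prems(2) have "4 + x \<le> 4 * k"
      by (simp add: lucas_coins_base coin_sums_atLeastAtMost lucas_values del: One_nat_def)
    then show ?thesis unfolding 2 lucas_coins_base coin_sums_atLeastAtMost
      by (intro exI[of _ "k - 1"]) auto
  next
    case (3 b)
    define n where "n = Suc (Suc b)"
    have a: "a = Suc (Suc n)" and n: "n \<ge> 2" by (simp_all add: 3 n_def)
    let ?C = "\<lambda>i. coin_sums (lucas ` {..i})"
    have mono: "?C n j \<subseteq> ?C (Suc n) j" "?C (Suc n) j \<subseteq> ?C a j" for j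
      unfolding a by (intro coin_sums_mono_coins image_mono; simp)+
    have coins: "lucas ` {..Suc i} = insert (lucas (Suc i)) (lucas ` {..i})" for i
      by (simp add: atMost_Suc)
    note coins_a = coins[of "Suc n", folded a]
    from less.prems(2) have "lucas a + x \<in> coin_sums (insert (lucas a) (lucas ` {..Suc n})) k"
      unfolding coins_a .
    then show ?thesis
    proof (cases rule: coin_sums_insert_cases)
      case (2 j y)
      then show ?thesis unfolding coins_a by auto
    next
      case 1
      then have "lucas (Suc n) + (lucas n + x) \<in> ?C (Suc n) k" by (simp add: a add.assoc)
      then obtain j where j: "k = Suc j" "lucas n + x \<in> ?C (Suc n) j"
        using less.IH[of "Suc n"] n a by auto
      from j(2) have "lucas n + x \<in> coin_sums (insert (lucas (Suc n)) (lucas ` {..n})) j"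
        unfolding coins .
      then show ?thesis
      proof (cases rule: coin_sums_insert_cases)
        case 1
        \<comment> \<open>Here two coins have been removed in place of \<open>lucas a\<close>, so
          one coin is even saved.\<close>
        then obtain i where "j = Suc i" "x \<in> ?C n i" using less.IH[of n] n a by auto
        then have "k = Suc j" "x \<in> ?C a j"
          using j mono coin_sums_mono[of i "Suc i"] by auto
        then show ?thesis by blast
      next
        case (2 i y)
        \<comment> \<open>Two copies of \<open>lucas (Suc n)\<close> were taken out. They are traded
          for \<open>lucas a\<close> and \<open>lucas (Suc b)\<close>, so the number of coins is
          unchanged.\<close>
        have "lucas (Suc n) = lucas n + lucas (Suc b)" by (simp add: n_def)
        then have "x = lucas (Suc b) + y" using 2 by simp
        moreover have "y \<in> ?C a i" using 2(3) mono unfolding coins[symmetric] by blast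
        ultimately have "x \<in> ?C a (Suc i)"
          using coin_sums_add_coin[of "lucas (Suc b)" "lucas ` {..a}" y i] by (simp add: 3)
        then show ?thesis using j 2 by blast
      qed
    qed
  qed
qed

text \<open>Since \<open>lucas a - 1 = lucas (a - 1) + (lucas (a - 2) - 1)\<close>, the greedy lemma
  removes one coin each time the index drops by two.\<close>

lemma coins_needed_lucas_minus_1:
  "2 \<le> a \<Longrightarrow> x + 1 = lucas a \<Longrightarrow> x \<in> coin_sums (lucas ` {..a}) k \<Longrightarrow> a div 2 \<le> k"
proof (induction a arbitrary: x k rule: less_induct)
  case (less a)
  consider "a = 2 \<or> a = 3" | b where "a = Suc (Suc b)" "2 \<le> b"
    using less.prems(1) by (metis One_nat_def Suc_1 not_less_eq_eq numeral_3_eq_3 old.nat.exhaust le0)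
  then show ?case
  proof cases
    case 1
    then have "k \<noteq> 0" using less.prems by (auto simp: lucas_values intro!: gr0I)
    then show ?thesis using 1 by auto
  next
    case (2 b)
    have coins: "lucas ` {..Suc i} = insert (lucas (Suc i)) (lucas ` {..i})" for i
      by (simp add: atMost_Suc)
    define y where "y = lucas b - 1"
    have y: "y + 1 = lucas b" using lucas_pos[of b] by (simp add: y_def)
    have "x \<in> coin_sums (lucas ` {..Suc b}) k"
      using less.prems coin_sums_insert_less[of x "lucas a" _ k] unfolding 2 coins[of "Suc b"] by simp
    moreover have "x = lucas (Suc b) + y" using less.prems(2) y 2 by simp
    ultimately obtain j where j: "k = Suc j" "y \<in> coin_sums (lucas ` {..Suc b}) j"
      using lucas_greedy[of "Suc b"] 2 by auto
    \<comment> \<open>As \<open>y < lucas b\<close>, the coin \<open>lucas (Suc b)\<close> cannot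
      occur in \<open>y\<close>.\<close>
    have "lucas b < lucas (Suc b)" using 2 by (intro lucas_less) auto
    then have "y \<in> coin_sums (lucas ` {..b}) j"
      using j(2) y unfolding coins by (auto intro: coin_sums_insert_less)
    then have "b div 2 \<le> j" using less.IH[of b] 2 y by simp
    then show ?thesis using 2 j by simp
  qed
qed

text \<open>The greedy lemma strips copies of \<open>lucas a\<close> until
  \<open>lucas a - 1\<close> is left.\<close>

lemma coins_needed_mult_lucas_minus_1:
  assumes "2 \<le> a" "x + 1 = c * lucas a" "x \<in> coin_sums (lucas ` {..a}) k"
  shows "a div 2 \<le> k"
  using assms(2,3)
proof (induction c arbitrary: x k)
  case (Suc c)
  show ?case
  proof (cases "c = 0")
    case True
    then show ?thesis using Suc.prems assms(1) coins_needed_lucas_minus_1 by simp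
  next
    case False
    define y where "y = c * lucas a - 1"
    have y: "y + 1 = c * lucas a" using False lucas_pos[of a] by (simp add: y_def Suc_leI)
    then have "x = lucas a + y" using Suc.prems by simp
    then obtain j where "k = Suc j" "y \<in> coin_sums (lucas ` {..a}) j"
      using lucas_greedy[OF assms(1)] Suc.prems by blast
    then show ?thesis using Suc.IH[OF y] by auto
  qed
qed simp

text \<open>One coin brings \<open>w\<close> down to at most \<open>lucas (a - 2)\<close>. The bound
  must include equality, since subtracting \<open>lucas n - 1\<close> leaves one more than
  subtracting \<open>lucas n\<close>. The case \<open>a = 3\<close> fails: 4 is not of the form
  \<open>lucas n - 1\<close>.\<close>

lemma le_lucas_in_coin_sums_pred:
  "4 \<le> a \<Longrightarrow> w \<le> lucas a \<Longrightarrow> w \<in> coin_sums (range (\<lambda>n. lucas n - 1)) (a div 2)"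
proof (induction a arbitrary: w rule: less_induct)
  case (less a)
  let ?D = "range (\<lambda>n. lucas n - 1)"
  have D: "lucas n - 1 \<in> ?D" for n by blast
  have one: "1 \<in> ?D" using D[of 0] by simp
  have two: "x + y \<in> coin_sums ?D 2" if "x \<in> ?D" "y \<in> ?D" for x y
    using coin_sums_add_coin[OF that(1) coin_in_coin_sums[OF that(2), of 0]]
    by (simp add: numeral_2_eq_2)
  consider "a = 4 \<or> a = 5" | b where "a = Suc (Suc b)" "4 \<le> b"
  proof -
    have "a = 4 \<or> a = 5 \<or> (\<exists>b. a = Suc (Suc b) \<and> 4 \<le> b)"
      using less.prems(1) by presburger
    then show thesis using that by blast
  qed
  then show ?case
  proof cases
    case 1
    have v: "0 \<in> ?D" "2 \<in> ?D" "3 \<in> ?D" "6 \<in> ?D" "10 \<in> ?D"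
      using D[of 1] D[of 2] D[of 3] D[of 4] D[of 5] by (simp_all add: lucas_values del: One_nat_def)
    have "w \<le> 11" using 1 less.prems(2) by (auto simp: lucas_values)
    \<comment> \<open>Explicit sums of two coins for 0, ..., 11, where
      \<open>11 = lucas 5\<close>.\<close>
    then have "w \<in> {0+0,0+1,0+2,0+3,3+1,3+2,3+3,6+1,6+2,6+3,10+0,10+1}" by (simp, arith)
    then have "w \<in> coin_sums ?D 2" using two v one by blast
    then show ?thesis using 1 by auto
  next
    case (2 b)
    have add: "(lucas n - 1) + x \<in> coin_sums ?D (a div 2)" if "x \<le> lucas b" for n x
      using coin_sums_add_coin[OF D[of n] less.IH[of b x]] that 2 by simp
    obtain c where c: "b = Suc c" using 2 by (cases b) auto
    have rec: "lucas a = lucas (Suc b) + lucas b" "lucas (Suc b) = lucas b + lucas c"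
      using 2 c by simp_all
    have "lucas c \<le> lucas b" using c 2 by (intro lucas_le) auto
    note facts = rec this lucas_pos[of a] lucas_pos[of b] lucas_pos[of "Suc b"]
    \<comment> \<open>The coin is \<open>lucas n - 1\<close> with \<open>n\<close> equal to
      \<open>1\<close>, \<open>b\<close>, \<open>Suc b\<close> and \<open>a\<close> in turn; for
      \<open>n = 1\<close> it is 0.\<close>
    consider "w \<le> lucas b" | "lucas b < w" "w < lucas (Suc b)" | "lucas (Suc b) \<le> w" "w < lucas a"
      | "w = lucas a" using less.prems(2) by linarith
    then show ?thesis
    proof cases
      case 1
      then show ?thesis using add[of w 1] by simp
    next
      case 2
      then show ?thesis using add[of "w - (lucas b - 1)" b] facts by simp
    next
      case 3
      then show ?thesis using add[of "w - (lucas (Suc b) - 1)" "Suc b"] facts by simp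
    next
      case 4
      then show ?thesis using add[of 1 a] facts by simp
    qed
  qed
qed

text \<open>The strict bound also admits the indices 2 and 3, which occur as \<open>a - 4\<close>
  when \<open>a\<close> is 6 or 7.\<close>

lemma less_lucas_in_coin_sums_pred:
  assumes "2 \<le> a" "w < lucas a"
  shows "w \<in> coin_sums (range (\<lambda>n. lucas n - 1)) (a div 2)"
proof (cases "4 \<le> a")
  case True
  then show ?thesis using assms le_lucas_in_coin_sums_pred by simp
next
  case False
  then have a: "a = 2 \<or> a = 3" using assms by auto
  let ?D = "range (\<lambda>n. lucas n - 1)"
  have D: "lucas n - 1 \<in> ?D" for n by blast
  have "w \<in> {lucas 1 - 1, lucas 0 - 1, lucas 2 - 1, lucas 3 - 1}"
    using a assms(2) by (auto simp: lucas_values simp del: One_nat_def)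
  then have "w \<in> coin_sums ?D (Suc 0)" using D coin_in_coin_sums by blast
  then show ?thesis using a by auto
qed


section \<open>The semigroups \<open>T a\<close>\<close>

lemma submonoid_T: "submonoid (T a)"
  by (simp add: T_def submonoid_submonoid_generated)

lemma generator_in_T: "lucas a + lucas n \<in> T a"
  unfolding T_def by (rule subsetD[OF submonoid_generated_inc]) simp

lemma T_nonzero_ge: "s \<in> T a \<Longrightarrow> s \<noteq> 0 \<Longrightarrow> lucas a + 1 \<le> s"
proof -
  have "T a \<subseteq> {s. s \<noteq> 0 \<longrightarrow> lucas a + 1 \<le> s}"
    unfolding T_def
  proof (rule submonoid_generated_subset)
    show "range (\<lambda>n. lucas a + lucas n) \<subseteq> {s. s \<noteq> 0 \<longrightarrow> lucas a + 1 \<le> s}"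
      using lucas_pos by (auto simp: Suc_le_eq)
  qed (auto simp: submonoid_def)
  then show "s \<in> T a \<Longrightarrow> s \<noteq> 0 \<Longrightarrow> lucas a + 1 \<le> s" by blast
qed

text \<open>A generator is \<open>lucas a + lucas n = m + (lucas n - 1)\<close> with \<open>m = lucas a + 1\<close>; as
  \<open>lucas 1 - 1 = 0\<close>, sums of at most \<open>k\<close> and of exactly \<open>k\<close> of the numbers \<open>lucas n - 1\<close>
  are the same.\<close>

lemma coin_sums_pred_in_T:
  "w \<in> coin_sums (range (\<lambda>n. lucas n - 1)) k \<Longrightarrow> k * (lucas a + 1) + w \<in> T a"
proof (induction k arbitrary: w)
  case 0
  then show ?case using submonoid_T by (simp add: submonoid_def)
next
  case (Suc k)
  have gen: "(lucas a + 1) + (lucas n - 1) \<in> T a" for n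
    using generator_in_T[of a n] lucas_pos[of n] by simp
  obtain n x where x: "w = (lucas n - 1) + x" "x \<in> coin_sums (range (\<lambda>n. lucas n - 1)) k"
  proof (cases "w \<in> coin_sums (range (\<lambda>n. lucas n - 1)) k")
    case True
    then show thesis using that[of 1 w] by simp
  next
    case False
    then show thesis using that Suc.prems by auto
  qed
  have "((lucas a + 1) + (lucas n - 1)) + (k * (lucas a + 1) + x) \<in> T a"
    using gen Suc.IH[OF x(2)] submonoid_T unfolding submonoid_def by blast
  then show ?case by (simp add: x(1) algebra_simps)
qed

lemma block_in_T:
  assumes "2 \<le> b" "x \<in> {b div 2 * (lucas a + 1)..<b div 2 * (lucas a + 1) + lucas b}"
  shows "x \<in> T a"
proof -
  let ?q = "b div 2 * (lucas a + 1)"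
  have "x - ?q < lucas b" using assms(2) by (simp only: atLeastLessThan_iff) linarith
  then have "?q + (x - ?q) \<in> T a"
    by (intro coin_sums_pred_in_T less_lucas_in_coin_sums_pred assms(1))
  moreover have "?q + (x - ?q) = x" using assms(2) by (simp only: atLeastLessThan_iff) linarith
  ultimately show ?thesis by (simp only:)
qed

text \<open>Divide by \<open>lucas a + 1\<close>: the quotient is at least \<open>k\<close>, which
  is enough coins for any remainder.\<close>

lemma in_T_of_ge:
  assumes residues: "\<And>w. w \<le> lucas a \<Longrightarrow> w \<in> coin_sums (range (\<lambda>n. lucas n - 1)) k"
    and x: "k * (lucas a + 1) \<le> x"
  shows "x \<in> T a"
proof -
  let ?m = "lucas a + 1"
  have "k \<le> x div ?m" using x by (simp add: less_eq_div_iff_mult_less_eq)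
  moreover have "x mod ?m \<le> lucas a" using mod_less_divisor[of ?m x] by simp
  ultimately have "x mod ?m \<in> coin_sums (range (\<lambda>n. lucas n - 1)) (x div ?m)"
    using residues coin_sums_mono by blast
  from coin_sums_pred_in_T[OF this, of a] show ?thesis by (simp only: div_mult_mod_eq)
qed

text \<open>Restricts to the coins that the greedy lemmas handle: for \<open>n > a\<close>,
  \<open>lucas n\<close> is itself in \<open>?U\<close>, as a sum of smaller elements.\<close>

lemma T_subset_bounded_coin_sums:
  assumes "2 \<le> a"
  shows "T a \<subseteq> {j * lucas a + s | j s. s \<in> coin_sums (lucas ` {..a}) j}" (is "_ \<subseteq> ?U")
proof -
  have U: "submonoid ?U"
    unfolding submonoid_def
  proof (intro conjI ballI)
    show "0 \<in> ?U" by (auto intro!: exI[of _ 0])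
    fix x y assume "x \<in> ?U" "y \<in> ?U"
    then obtain i j s t where "x = i * lucas a + s" "y = j * lucas a + t"
      "s \<in> coin_sums (lucas ` {..a}) i" "t \<in> coin_sums (lucas ` {..a}) j" by blast
    then have "x + y = (i + j) * lucas a + (s + t)" "s + t \<in> coin_sums (lucas ` {..a}) (i + j)"
      by (auto simp: algebra_simps intro: coin_sums_add)
    then show "x + y \<in> ?U" by blast
  qed
  have gen: "lucas a + lucas n \<in> ?U" if "n \<le> a" for n
  proof -
    have "lucas n \<in> coin_sums (lucas ` {..a}) 1"
      using that coin_in_coin_sums[of "lucas n" "lucas ` {..a}" 0] by simp
    then show ?thesis by (intro CollectI exI[of _ 1] exI[of _ "lucas n"]) simp
  qed
  have top: "lucas a \<in> ?U"
    by (intro CollectI exI[of _ 1] exI[of _ 0]) (simp add: zero_in_coin_sums)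
  obtain b where b: "a = Suc b" using assms by (cases a) auto
  have "lucas (Suc a) \<in> ?U" using gen[of b] b by simp
  moreover from this have "lucas (Suc (Suc a)) \<in> ?U"
    using U top unfolding submonoid_def lucas.simps by blast
  \<comment> \<open>Two consecutive indices are carried along so that the Lucas recurrence closes
    the induction.\<close>
  ultimately have large: "lucas (Suc (a + n)) \<in> ?U \<and> lucas (Suc (Suc (a + n))) \<in> ?U" for n
  proof (induction n)
    case (Suc n)
    then show ?case using U unfolding submonoid_def by (auto simp only: add_Suc_right lucas.simps)
  qed simp
  have "lucas a + lucas n \<in> ?U" for n
  proof (cases "n \<le> a")
    case False
    then obtain i where "n = Suc (a + i)" using less_iff_Suc_add by (metis not_le)
    then show ?thesis using large U top unfolding submonoid_def by blast
  qed (rule gen)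
  then show ?thesis unfolding T_def by (intro submonoid_generated_subset U) blast
qed

text \<open>A representation with \<open>j\<close> generators forces \<open>j < ?K\<close> and
  \<open>s + 1 = (?K - j) * lucas a\<close>; but such an \<open>s\<close> needs at least
  \<open>?K\<close> coins.\<close>

lemma gap_T:
  assumes "2 \<le> a"
  shows "a div 2 * lucas a - 1 \<notin> T a"
proof
  let ?K = "a div 2"
  assume "?K * lucas a - 1 \<in> T a"
  then obtain j s where s: "?K * lucas a - 1 = j * lucas a + s" "s \<in> coin_sums (lucas ` {..a}) j"
    using T_subset_bounded_coin_sums[OF assms] by blast
  have "?K * lucas a > 0" using assms lucas_pos by simp
  then have eq: "j * lucas a + (s + 1) = ?K * lucas a" using s(1) by linarith
  then have "j * lucas a < ?K * lucas a" by linarith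
  then have "j < ?K" by simp
  have "s + 1 = (?K - j) * lucas a" using eq by (simp add: diff_mult_distrib)
  then have "?K \<le> j" using coins_needed_mult_lucas_minus_1 assms s(2) by blast
  then show False using \<open>j < ?K\<close> by simp
qed

section \<open>Counting generators and the cases of Wilf's inequality\<close>

lemma card_generators:
  "card ((\<lambda>n. lucas a + lucas n) ` {..a}) = a + 1"
  by (subst card_image) (auto intro!: inj_onI dest: injD[OF inj_lucas])

lemma generators_below:
  assumes "2 \<le> a"
  shows "(\<lambda>n. lucas a + lucas n) ` {..a} \<subseteq> T a \<inter> {lucas a + 1..<2 * (lucas a + 1)}"
  using generator_in_T lucas_pos lucas_le[OF _ assms] by (fastforce simp: Suc_le_eq)

lemma wilf_T_ge_6:
  assumes a: "6 \<le> a"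
  shows "frobenius_number (T a) + 1
           \<le> int (embedding_dimension (T a)) * int (num_below_frobenius (T a))"
proof -
  define K m where "K = a div 2" and "m = lucas a + 1"
  define c where "c = a - 6"
  have c: "a = Suc (Suc (Suc (Suc (Suc (Suc c)))))" using a by (simp add: c_def)
  define B where "B = {(K-1) * m..<(K-1) * m + lucas (a-2)} \<union> {(K-2) * m..<(K-2) * m + lucas (a-4)}"
  have K: "K \<ge> 3" using a by (simp add: K_def)
  have K1: "(a-2) div 2 = K - 1" and K2: "(a-4) div 2 = K - 2" by (simp_all add: K_def c)
  have less4: "lucas (a-4) < m" using lucas_less[of "a-4" a] a by (simp add: m_def)
  obtain k where k: "K = 3 + k" using K le_Suc_ex by blast
  have e1: "(K-1) * m = (K-2) * m + m" by (simp add: k)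
  \<comment> \<open>After cancelling \<open>(K-1) * lucas a\<close> and \<open>lucas (a-2)\<close>,
    the claim \<open>below\<close> amounts to \<open>K \<le> lucas (a-1)\<close>.\<close>
  have "K \<le> lucas (a-1)" using le_lucas[of "a-1"] a by (simp add: K_def)
  moreover have "lucas a = lucas (a-1) + lucas (a-2)" by (simp add: c)
  moreover have "(K-1) * m = (K-1) * lucas a + (K-1)" by (simp add: m_def)
  moreover have "K * lucas a = (K-1) * lucas a + lucas a" by (simp add: k algebra_simps)
  ultimately have below: "(K-1) * m + lucas (a-2) \<le> K * lucas a - 1"
    using K by linarith
  have "card B = lucas (a-2) + lucas (a-4)"
    unfolding B_def by (subst card_Un_disjoint) (use e1 less4 in auto)
  \<comment> \<open>This identity gives \<open>2 * card B = lucas a + lucas (a-6)\<close>, which is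
    at least \<open>m\<close>.\<close>
  moreover have "lucas a + lucas (a-6) = 2 * (lucas (a-2) + lucas (a-4))" by (simp add: c)
  ultimately have cardB: "m \<le> 2 * card B" using lucas_pos[of "a-6"] by (simp add: m_def)
  show ?thesis
  proof (rule wilf_criterion[OF submonoid_T _ T_nonzero_ge generators_below _ gap_T])
    show "x \<in> T a" if "K * m \<le> x" for x
      using in_T_of_ge[of a K] le_lucas_in_coin_sums_pred[of a] a that by (simp add: K_def m_def)
    show "B \<subseteq> T a \<inter> {..<a div 2 * lucas a - 1}"
    proof
      fix x assume x: "x \<in> B"
      then have "x \<in> T a" using block_in_T[of "a-2" x a] block_in_T[of "a-4" x a] a
        unfolding B_def K1 K2 m_def by auto
      moreover have "x < K * lucas a - 1" using x below e1 less4 unfolding B_def by auto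
      ultimately show "x \<in> T a \<inter> {..<a div 2 * lucas a - 1}" by (simp add: K_def)
    qed
    have "K * m \<le> K * (2 * card B)" using cardB by simp
    also have "\<dots> = (2 * K) * card B" by simp
    also have "\<dots> \<le> (a + 1) * card B" by (intro mult_le_mono1) (simp add: K_def)
    finally show "K * m \<le> card ((\<lambda>n. lucas a + lucas n) ` {..a}) * card B"
      by (simp only: card_generators)
  qed (use a in auto)
qed

text \<open>The index \<open>a - 4\<close> is too small for \<open>block_in_T\<close>, so
  \<open>?B\<close> consists of 0 and three generators. The final bounds are
  \<open>16 \<le> 5 * 4\<close> and \<open>24 \<le> 6 * 4\<close>.\<close>

lemma wilf_T_4_5:
  assumes a: "a = 4 \<or> a = 5"
  shows "frobenius_number (T a) + 1
           \<le> int (embedding_dimension (T a)) * int (num_below_frobenius (T a))"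
proof (rule wilf_criterion[OF submonoid_T _ T_nonzero_ge generators_below _ gap_T])
  let ?B = "{0, lucas a + 1, lucas a + 2, lucas a + 3}"
  show "x \<in> T a" if "a div 2 * (lucas a + 1) \<le> x" for x
    using in_T_of_ge[OF _ that] le_lucas_in_coin_sums_pred[of a] a by auto
  have "0 \<in> T a" using submonoid_T by (simp add: submonoid_def)
  then show "?B \<subseteq> T a \<inter> {..<a div 2 * lucas a - 1}"
    using generator_in_T[of a 1] generator_in_T[of a 0] generator_in_T[of a 2] a
    by (auto simp: lucas_values)
  show "a div 2 * (lucas a + 1) \<le> card ((\<lambda>n. lucas a + lucas n) ` {..a}) * card ?B"
    unfolding card_generators using a by (auto simp: lucas_values)
qed (use a in auto)

text \<open>The residue 4 needs two coins here, so the bound is 10, and the gap is 9 instead of the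
  one from \<open>gap_T\<close>.\<close>

lemma wilf_T_3:
  "frobenius_number (T 3) + 1
     \<le> int (embedding_dimension (T 3)) * int (num_below_frobenius (T 3))"
proof (rule wilf_criterion[OF submonoid_T _ T_nonzero_ge generators_below])
  let ?D = "range (\<lambda>n. lucas n - 1)"
  have three: "3 \<in> ?D" using rangeI[of "\<lambda>n. lucas n - 1" 3] by (simp add: lucas_values)
  have one: "1 \<in> ?D" using rangeI[of "\<lambda>n. lucas n - 1" 0] by simp
  have "w \<in> coin_sums ?D 2" if "w \<le> lucas 3" for w
  proof (cases "w = 4")
    case True
    then show ?thesis using coin_sums_add_coin[OF three coin_in_coin_sums[OF one, of 0]]
      by (simp add: numeral_2_eq_2)
  next
    case False
    then have "w \<in> coin_sums ?D 1"
      using less_lucas_in_coin_sums_pred[of 3 w] that by (simp add: lucas_values)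
    then show ?thesis using coin_sums_mono[of 1 2] by (metis one_le_numeral subsetD)
  qed
  then show "x \<in> T 3" if "10 \<le> x" for x
    using in_T_of_ge[of 3 2 x] that by (simp add: lucas_values)
  have "0 \<in> T 3" using submonoid_T by (simp add: submonoid_def)
  then show "{0, 5, 6} \<subseteq> T 3 \<inter> {..<9}"
    using generator_in_T[of 3 1] generator_in_T[of 3 0] by (auto simp: lucas_values)
  \<comment> \<open>The right side is closed under addition because two nonzero elements add up to
    at least 10. No generator is 9, as 5 is not a Lucas number.\<close>
  have "T 3 \<subseteq> {s. s = 0 \<or> 5 \<le> s \<and> s \<noteq> 9}"
    unfolding T_def
  proof (rule submonoid_generated_subset)
    have "lucas n \<noteq> 5" for n
    proof (cases "n \<le> 3")
      case True
      then have "lucas n \<in> lucas ` {..3}" by simp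
      then show ?thesis unfolding lucas_coins_base by auto
    next
      case False
      then show ?thesis using lucas_le[of 4 n] by (simp add: lucas_values)
    qed
    then show "range (\<lambda>n. lucas 3 + lucas n) \<subseteq> {s. s = 0 \<or> 5 \<le> s \<and> s \<noteq> 9}"
      using lucas_pos by (auto simp: lucas_values Suc_le_eq)
  qed (auto simp: submonoid_def)
  then show "9 \<notin> T 3" by auto
  show "10 \<le> card ((\<lambda>n. lucas 3 + lucas n) ` {..3}) * card {0, 5, 6 :: nat}"
    unfolding card_generators by simp
qed auto

text \<open>Here \<open>T a = {0} \<union> {m..}\<close> with \<open>m = lucas a + 1\<close>.\<close>

lemma wilf_T_le_2:
  assumes a: "a \<le> 2"
  shows "frobenius_number (T a) + 1
           \<le> int (embedding_dimension (T a)) * int (num_below_frobenius (T a))"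
proof -
  let ?m = "lucas a + 1"
  have "lucas a \<le> 3" using lucas_le[OF a] by (simp add: lucas_values)
  \<comment> \<open>Index 3 serves all three cases: residues below \<open>lucas 3 = 4\<close> need
    only \<open>3 div 2 = 1\<close> coin.\<close>
  then have "w \<in> coin_sums (range (\<lambda>n. lucas n - 1)) 1" if "w \<le> lucas a" for w
    using less_lucas_in_coin_sums_pred[of 3 w] that by (simp add: lucas_values)
  then have large: "x \<in> T a" if "?m \<le> x" for x
    using in_T_of_ge[of a 1 x] that by simp
  show ?thesis
  proof (rule wilf_criterion[OF submonoid_T large T_nonzero_ge])
    \<comment> \<open>The whole interval consists of \<open>?m\<close> atoms, so the single element
      0 below the gap 1 suffices.\<close>
    show "{?m..<2 * ?m} \<subseteq> T a \<inter> {?m..<2 * ?m}" using large by auto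
    show "{0} \<subseteq> T a \<inter> {..<1}" using submonoid_T by (simp add: submonoid_def)
    show "1 \<notin> T a" using T_nonzero_ge[of 1 a] lucas_pos[of a] by auto
  qed auto
qed

theorem mainTheorem8:
  fixes a :: nat
  shows "frobenius_number (T a) + 1
           \<le> int (embedding_dimension (T a)) * int (num_below_frobenius (T a))"
proof -
  consider "a \<le> 2" | "a = 3" | "a = 4 \<or> a = 5" | "6 \<le> a" by linarith
  then show ?thesis
    using wilf_T_le_2 wilf_T_3 wilf_T_4_5 wilf_T_ge_6 by cases auto
qed

end
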